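(* For all integers $n\geq 5$ and $p\geq 0$, $$\mathcal{A}(C_n\cup pK_1)>\mathcal{A}(P_n\cup pK_1).$$
   Context: Graphs are finite and simple. For a graph $G$ and an integer $k$, $S(G,k)$ is the number of partitions of the vertex set of $G$ into exactly $k$ nonempty stable sets (sets of pairwise non-adjacent vertices). Put $\mathcal{B}(G)=\sum_{k}S(G,k)$, $\mathcal{T}(G)=\sum_{k}k\,S(G,k)$ and $\mathcal{A}(G)=\mathcal{T}(G)/\mathcal{B}(G)$ (the average number of colors in the non-equivalent colorings of $G$). $P_n$ and $C_n$ are the path and the cycle on $n$ vertices, and $G\cup pK_1$ is the graph obtained from $G$ by adding $p$ isolated vertices. *)

theory Defs
  imports Complex_Main "Graph_Theory.Pair_Digraph" "HOL-Library.Disjoint_Sets"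
begin

text \<open>
  Finite simple graphs are the structures satisfying \<^locale>\<open>pair_graph\<close>: finite, symmetric,
  loopfree, without parallel arcs. An undirected edge is a pair of opposite arcs.
\<close>

definition stable_set :: "'a pair_pre_digraph \<Rightarrow> 'a set \<Rightarrow> bool" where
  "stable_set G X \<longleftrightarrow> X \<subseteq> pverts G \<and> (\<forall>u\<in>X. \<forall>v\<in>X. (u, v) \<notin> parcs G)"

definition stable_partitions :: "'a pair_pre_digraph \<Rightarrow> nat \<Rightarrow> 'a set set set" where
  "stable_partitions G k =
     {P. partition_on (pverts G) P \<and> (\<forall>X\<in>P. stable_set G X) \<and> card P = k}"

definition S :: "'a pair_pre_digraph \<Rightarrow> nat \<Rightarrow> nat" where
  "S G k = card (stable_partitions G k)"

text \<open>
  The sums over all \<open>k\<close> may stop at the number of vertices, by \<open>S_eq_0\<close> below.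
\<close>

definition \<B> :: "'a pair_pre_digraph \<Rightarrow> nat" where
  "\<B> G = (\<Sum>k\<le>card (pverts G). S G k)"

definition \<T> :: "'a pair_pre_digraph \<Rightarrow> nat" where
  "\<T> G = (\<Sum>k\<le>card (pverts G). k * S G k)"

definition \<A> :: "'a pair_pre_digraph \<Rightarrow> real" where
  "\<A> G = real (\<T> G) / real (\<B> G)"

definition path_graph :: "nat \<Rightarrow> nat pair_pre_digraph" where
  "path_graph n = \<lparr> pverts = {..<n},
     parcs = {(i, j). i < n \<and> j < n \<and> (j = Suc i \<or> i = Suc j)} \<rparr>"

text \<open>Meaningful for \<open>n \<ge> 3\<close> only; for \<open>n = 1\<close> the formula gives a loop.\<close>

definition cycle_graph :: "nat \<Rightarrow> nat pair_pre_digraph" where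
  "cycle_graph n = \<lparr> pverts = {..<n},
     parcs = {(i, j). i < n \<and> j < n \<and> (j = Suc i mod n \<or> i = Suc j mod n)} \<rparr>"

definition add_isolated :: "'a pair_pre_digraph \<Rightarrow> nat \<Rightarrow> ('a + nat) pair_pre_digraph" where
  "add_isolated G p = \<lparr> pverts = pverts G <+> {..<p},
     parcs = map_prod Inl Inl ` parcs G \<rparr>"

lemma S_eq_0:
  assumes "finite (pverts G)" "k > card (pverts G)"
  shows "S G k = 0"
proof -
  have "card P \<le> card (pverts G)" if "partition_on (pverts G) P" for P
  proof -
    have d: "disjoint P" "{} \<notin> P" "\<Union>P = pverts G"
      using that by (auto simp: partition_on_def)
    have fin: "finite P"
      using d(3) assms(1) by (metis finite_UnionD)
    have finX: "finite X" if "X \<in> P" for X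
      using that d(3) assms(1) by (metis Union_upper finite_subset)
    have "card P = (\<Sum>X\<in>P. 1)" by simp
    also have "\<dots> \<le> (\<Sum>X\<in>P. card X)"
      using d(2) finX by (intro sum_mono) (metis One_nat_def Suc_leI card_gt_0_iff)
    also have "\<dots> = card (\<Union>P)"
      using d(1) finX by (simp add: card_Union_disjoint)
    finally show ?thesis using d(3) by simp
  qed
  then have "stable_partitions G k = {}"
    using assms(2) by (fastforce simp: stable_partitions_def)
  then show ?thesis by (simp add: S_def)
qed

lemma pair_graph_path_graph: "pair_graph (path_graph n)"
proof -
  have "finite (parcs (path_graph n))"
    by (rule finite_subset[of _ "{..<n} \<times> {..<n}"]) (auto simp: path_graph_def)
  then show ?thesis
    by unfold_locales (auto simp: path_graph_def symmetric_def sym_def)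
qed

lemma pair_graph_cycle_graph:
  assumes "n \<ge> 3"
  shows "pair_graph (cycle_graph n)"
proof -
  have "finite (parcs (cycle_graph n))"
    by (rule finite_subset[of _ "{..<n} \<times> {..<n}"]) (auto simp: cycle_graph_def)
  moreover have "Suc i mod n \<noteq> i" "i \<noteq> Suc i mod n" if "i < n" for i
    using assms that by (auto simp: mod_Suc split: if_splits)
  ultimately show ?thesis
    by unfold_locales (auto simp: cycle_graph_def symmetric_def sym_def)
qed

lemma pair_graph_add_isolated:
  assumes "pair_graph G"
  shows "pair_graph (add_isolated G p)"
proof -
  interpret G: pair_graph G by (fact assms)
  show ?thesis
  proof unfold_locales
    show "symmetric (with_proj (add_isolated G p))"
      using G.pair_sym_arcs by (auto simp: add_isolated_def symmetric_def sym_def)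
  qed (use G.pair_finite_verts G.pair_finite_arcs in
        \<open>auto simp: add_isolated_def dest: G.in_arcsD1 G.in_arcsD2 G.pair_no_loops\<close>)
qed

end

theory Submission
  imports Defs
begin

text \<open>
  Let \<open>\<chi>\<close> be the chromatic polynomial of \<open>G\<close>, expanded in falling factorials with coefficients
  \<open>S G k\<close>. As in Dobinski's formula, \<open>\<Sum>x. \<chi> x / x!\<close> is \<open>e \<B>(G)\<close> and \<open>\<Sum>x. x \<chi> x / x!\<close> is
  \<open>e (\<T>(G) + \<B>(G))\<close>, so \<open>\<A>(G) + 1\<close> is the mean of \<open>x\<close> with respect to the weights \<open>\<chi> x / x!\<close>.
  By deletion-contraction \<open>\<chi>\<close> of \<open>P_n\<close> is the sum of those of \<open>C_n\<close> and \<open>C_(n-1)\<close>, so it suffices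
  that the mean for \<open>C_(n-1)\<close> is smaller than the one for \<open>P_n\<close>. With \<open>m = n - 1\<close> these weights are
  \<open>x^p ((x-1)^m + (-1)^m (x-1)) / x!\<close> and \<open>x^p x (x-1)^m / x!\<close>. The second divided by the first is \<open>x\<close>
  up to an error that is small from \<open>x = 3\<close> on, hence essentially increasing, which shifts the mean
  upwards. The only exception is \<open>x = 2\<close> for odd \<open>m\<close>, where the cycle has weight \<open>0\<close>; the loss
  there is compensated by the terms \<open>x = 3, 4, 5\<close>.
\<close>

section \<open>Colorings and stable partitions\<close>

text \<open>The cardinality is the chromatic polynomial at \<open>x\<close>. Functions are
  extensional, so that values off \<open>pverts G\<close> do not multiply the count.\<close>

definition colorings :: "'a pair_pre_digraph \<Rightarrow> nat \<Rightarrow> ('a \<Rightarrow> nat) set" where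
  "colorings G x = {f \<in> pverts G \<rightarrow>\<^sub>E {..<x}. \<forall>(u, v)\<in>parcs G. f u \<noteq> f v}"

text \<open>Only attained colors index the classes, so none is empty.\<close>

definition color_classes :: "'a set \<Rightarrow> ('a \<Rightarrow> 'b) \<Rightarrow> 'a set set" where
  "color_classes V f = (\<lambda>c. {v \<in> V. f v = c}) ` f ` V"

lemma partition_on_color_classes: "partition_on V (color_classes V f)"
  by (rule partition_onI) (auto simp: color_classes_def disjnt_def)

text \<open>Being constant on blocks and separating distinct blocks is a condition on pairs of
  vertices, easier to check for the maps below than an equality of set systems.\<close>

lemma color_classes_eq_iff:
  assumes "partition_on V P"
  shows "color_classes V f = P \<longleftrightarrow>
    (\<forall>X\<in>P. \<forall>Y\<in>P. \<forall>u\<in>X. \<forall>v\<in>Y. f u = f v \<longleftrightarrow> X = Y)"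
proof -
  have V: "V = \<Union>P" and ne: "{} \<notin> P" using assms by (auto simp: partition_on_def)
  show ?thesis
  proof
    assume eq: "color_classes V f = P"
    show "\<forall>X\<in>P. \<forall>Y\<in>P. \<forall>u\<in>X. \<forall>v\<in>Y. f u = f v \<longleftrightarrow> X = Y"
    proof (intro ballI)
      fix X Y u v assume "X \<in> P" "Y \<in> P" and uv: "u \<in> X" "v \<in> Y"
      then obtain c d where "X = {v \<in> V. f v = c}" "Y = {v \<in> V. f v = d}"
        using eq by (auto simp: color_classes_def)
      with uv show "f u = f v \<longleftrightarrow> X = Y" by auto
    qed
  next
    assume *: "\<forall>X\<in>P. \<forall>Y\<in>P. \<forall>u\<in>X. \<forall>v\<in>Y. f u = f v \<longleftrightarrow> X = Y"
    have cls: "{v \<in> V. f v = f u} = X" if X: "X \<in> P" "u \<in> X" for X u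
    proof
      show "X \<subseteq> {v \<in> V. f v = f u}"
      proof
        fix v assume v: "v \<in> X"
        then have "v \<in> V" unfolding V using X(1) by (rule UnionI[rotated])
        then show "v \<in> {v \<in> V. f v = f u}"
          using *[rule_format, OF X(1) X(1) v X(2)] by simp
      qed
      show "{v \<in> V. f v = f u} \<subseteq> X"
      proof
        fix v assume v: "v \<in> {v \<in> V. f v = f u}"
        then have "v \<in> \<Union>P" unfolding V by simp
        then obtain Y where Y: "Y \<in> P" "v \<in> Y" by (rule UnionE)
        with v have "Y = X" using *[rule_format, OF Y(1) X(1) Y(2) X(2)] by simp
        with Y show "v \<in> X" by simp
      qed
    qed
    have "color_classes V f = (\<lambda>u. {v \<in> V. f v = f u}) ` V"
      by (auto simp: color_classes_def)
    also have "\<dots> = P"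
    proof
      show "(\<lambda>u. {v \<in> V. f v = f u}) ` V \<subseteq> P"
      proof (rule image_subsetI)
        fix u assume "u \<in> V"
        then obtain X where "X \<in> P" "u \<in> X" using V by blast
        with cls[OF this] show "{v \<in> V. f v = f u} \<in> P" by simp
      qed
      show "P \<subseteq> (\<lambda>u. {v \<in> V. f v = f u}) ` V"
      proof
        fix X assume X: "X \<in> P"
        then obtain u where u: "u \<in> X" using ne by (metis ex_in_conv)
        then have "u \<in> V" using V X by blast
        with cls[OF X u] show "X \<in> (\<lambda>u. {v \<in> V. f v = f u}) ` V" by (intro image_eqI) auto
      qed
    qed
    finally show "color_classes V f = P" .
  qed
qed

text \<open>Such a map amounts to an injective choice of one color per block, hence the falling
  factorial. With more blocks than colors, truncated subtraction yields a factor
  \<open>0\<close>.\<close>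

lemma card_maps_with_color_classes:
  fixes C :: "'b set"
  assumes "finite V" "finite C" "partition_on V P"
  shows "card {f \<in> V \<rightarrow>\<^sub>E C. color_classes V f = P} = (\<Prod>i<card P. card C - i)"
proof -
  have d: "\<Union>P = V" "{} \<notin> P" "\<And>X Y v. X \<in> P \<Longrightarrow> Y \<in> P \<Longrightarrow> v \<in> X \<Longrightarrow> v \<in> Y \<Longrightarrow> X = Y"
    using assms(3) by (auto simp: partition_on_def disjoint_def)
  define blk where "blk v = (THE X. X \<in> P \<and> v \<in> X)" for v
  have blk: "blk v = X" if "X \<in> P" "v \<in> X" for v X
    unfolding blk_def using that d(3) by (intro the_equality) auto
  \<comment> \<open>Any representative will do: \<open>f\<close> is constant on blocks, so
    \<open>f (rep X)\<close> is the color of the block.\<close>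
  define rep where "rep X = (SOME v. v \<in> X)" for X :: "'a set"
  have rep: "rep X \<in> X" if "X \<in> P" for X
    using that d(2) unfolding rep_def by (metis ex_in_conv someI_ex)
  have repV: "rep X \<in> V" if "X \<in> P" for X
    using rep[OF that] that d(1) by blast
  have blkP: "blk v \<in> P" "v \<in> blk v" if "v \<in> V" for v
    using that d(1) blk by blast+
  let ?I = "{g \<in> P \<rightarrow>\<^sub>E C. inj_on g P}" and ?F = "{f \<in> V \<rightarrow>\<^sub>E C. color_classes V f = P}"
  have "bij_betw (\<lambda>g. \<lambda>v\<in>V. g (blk v)) ?I ?F"
  proof (rule bij_betw_byWitness[where f' = "\<lambda>f. \<lambda>X\<in>P. f (rep X)"])
    show "\<forall>g\<in>?I. (\<lambda>X\<in>P. (\<lambda>v\<in>V. g (blk v)) (rep X)) = g"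
    proof
      fix g assume g: "g \<in> ?I"
      show "(\<lambda>X\<in>P. (\<lambda>v\<in>V. g (blk v)) (rep X)) = g"
      proof (rule extensionalityI[of _ P])
        show "g \<in> extensional P" using g by (auto simp: PiE_def)
      qed (use blk rep repV in auto)
    qed
    show "\<forall>f\<in>?F. (\<lambda>v\<in>V. (\<lambda>X\<in>P. f (rep X)) (blk v)) = f"
    proof
      fix f assume f: "f \<in> ?F"
      have c: "\<forall>X\<in>P. \<forall>Y\<in>P. \<forall>u\<in>X. \<forall>v\<in>Y. f u = f v \<longleftrightarrow> X = Y"
        using f color_classes_eq_iff[OF assms(3)] by blast
      show "(\<lambda>v\<in>V. (\<lambda>X\<in>P. f (rep X)) (blk v)) = f"
      proof (rule extensionalityI[of _ V])
        show "f \<in> extensional V" using f by (auto simp: PiE_def)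
        fix v assume v: "v \<in> V"
        have "f (rep (blk v)) = f v"
          using c[rule_format, of "blk v" "blk v" "rep (blk v)" v] blkP[OF v] rep by simp
        then show "(\<lambda>v\<in>V. (\<lambda>X\<in>P. f (rep X)) (blk v)) v = f v"
          using v blkP by simp
      qed auto
    qed
    show "(\<lambda>g. \<lambda>v\<in>V. g (blk v)) ` ?I \<subseteq> ?F"
    proof (rule image_subsetI)
      fix g assume g: "g \<in> ?I"
      have "color_classes V (\<lambda>v\<in>V. g (blk v)) = P"
        unfolding color_classes_eq_iff[OF assms(3)]
      proof (intro ballI)
        fix X Y u v assume *: "X \<in> P" "Y \<in> P" "u \<in> X" "v \<in> Y"
        then have "u \<in> V" "v \<in> V" using d(1) by auto
        with * g show "(restrict (\<lambda>v. g (blk v)) V u = restrict (\<lambda>v. g (blk v)) V v) \<longleftrightarrow> X = Y"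
          by (auto simp: blk inj_on_def)
      qed
      moreover have "(\<lambda>v\<in>V. g (blk v)) \<in> V \<rightarrow>\<^sub>E C"
        using g blkP by auto
      ultimately show "(\<lambda>v\<in>V. g (blk v)) \<in> ?F" by simp
    qed
    show "(\<lambda>f. \<lambda>X\<in>P. f (rep X)) ` ?F \<subseteq> ?I"
    proof (rule image_subsetI)
      fix f assume f: "f \<in> ?F"
      have c: "\<forall>X\<in>P. \<forall>Y\<in>P. \<forall>u\<in>X. \<forall>v\<in>Y. f u = f v \<longleftrightarrow> X = Y"
        using f color_classes_eq_iff[OF assms(3)] by blast
      have "inj_on (\<lambda>X\<in>P. f (rep X)) P"
        using c rep by (auto simp: inj_on_def)
      then show "(\<lambda>X\<in>P. f (rep X)) \<in> ?I"
        using f repV by auto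
    qed
  qed
  then have "card ?F = card ?I" by (simp add: bij_betw_same_card)
  also have "\<dots> = (\<Prod>i<card P. card C - i)"
    using card_inj_on_subset_funcset[of P C P] assms finite_elements
    by (auto simp: atLeast0LessThan)
  finally show ?thesis .
qed

text \<open>An edge has equal end colors exactly when one class contains both ends, so properness
  depends on the classes alone.\<close>

lemma colorings_color_classes:
  assumes "pair_graph G" "partition_on (pverts G) P"
  shows "{f \<in> colorings G x. color_classes (pverts G) f = P} =
    (if \<forall>X\<in>P. stable_set G X
     then {f \<in> pverts G \<rightarrow>\<^sub>E {..<x}. color_classes (pverts G) f = P} else {})"
proof -
  interpret pair_graph G by fact
  have "(\<forall>(u, v)\<in>parcs G. f u \<noteq> f v) \<longleftrightarrow> (\<forall>X\<in>P. stable_set G X)"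
    if P: "color_classes (pverts G) f = P" for f :: "'a \<Rightarrow> nat"
  proof
    assume "\<forall>(u, v)\<in>parcs G. f u \<noteq> f v"
    then show "\<forall>X\<in>P. stable_set G X"
      by (auto simp: P[symmetric] color_classes_def stable_set_def)
  next
    assume st: "\<forall>X\<in>P. stable_set G X"
    have "f u \<noteq> f v" if "(u, v) \<in> parcs G" for u v
    proof
      assume "f u = f v"
      have "u \<in> pverts G" "v \<in> pverts G" using that in_arcsD1 in_arcsD2 by auto
      moreover from this have "{w \<in> pverts G. f w = f u} \<in> P"
        by (auto simp: P[symmetric] color_classes_def)
      ultimately show False
        using st that \<open>f u = f v\<close> unfolding stable_set_def by fastforce
    qed
    then show "\<forall>(u, v)\<in>parcs G. f u \<noteq> f v" by auto
  qed
  then show ?thesis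
    by (auto simp: colorings_def)
qed

text \<open>Grouping colorings by their color classes expands the chromatic polynomial in falling
  factorials.\<close>

lemma card_colorings:
  assumes "pair_graph G"
  shows "card (colorings G x) = (\<Sum>k\<le>card (pverts G). S G k * (\<Prod>i<k. x - i))"
proof -
  interpret pair_graph G by fact
  let ?V = "pverts G" and ?K = "color_classes (pverts G)"
  let ?Q = "{P. partition_on ?V P}"
  let ?R = "{P \<in> ?Q. \<forall>X\<in>P. stable_set G X}"
  have finQ: "finite ?Q" by (rule finitely_many_partition_on) simp
  have finC: "finite (colorings G x)"
    unfolding colorings_def by (rule finite_subset[OF _ finite_PiE[of ?V "\<lambda>_. {..<x}"]]) auto
  \<comment> \<open>By \<open>S_eq_0\<close> no stable partition has more than
    \<open>card ?V\<close> blocks, so the sum over block counts may stop there.\<close>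
  have card_le: "card P \<le> card ?V" if "P \<in> ?R" for P
  proof (rule ccontr)
    assume "\<not> ?thesis"
    then have "S G (card P) = 0" by (intro S_eq_0) auto
    moreover have "finite (stable_partitions G (card P))"
      by (rule finite_subset[OF _ finQ]) (auto simp: stable_partitions_def)
    moreover have "P \<in> stable_partitions G (card P)"
      using that by (auto simp: stable_partitions_def)
    ultimately show False by (auto simp: S_def)
  qed
  have "card (colorings G x) = (\<Sum>P\<in>?Q. card {f \<in> colorings G x. ?K f = P})"
  proof -
    have "?K ` colorings G x \<subseteq> ?Q" using partition_on_color_classes by blast
    from sum.group[OF finC finQ this, of "\<lambda>_. 1::nat"] show ?thesis by simp
  qed
  also have "\<dots> = (\<Sum>P\<in>?R. \<Prod>i<card P. x - i)"
  proof (rule sum.mono_neutral_cong_right[OF finQ])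
    show "\<forall>P\<in>?Q - ?R. card {f \<in> colorings G x. ?K f = P} = 0"
    proof
      fix P assume "P \<in> ?Q - ?R"
      then show "card {f \<in> colorings G x. ?K f = P} = 0"
        using colorings_color_classes[OF assms, of P x] by auto
    qed
    fix P assume "P \<in> ?R"
    then show "card {f \<in> colorings G x. ?K f = P} = (\<Prod>i<card P. x - i)"
      using colorings_color_classes[OF assms, of P x]
        card_maps_with_color_classes[of ?V "{..<x}" P] by auto
  qed auto
  also have "\<dots> = (\<Sum>k\<le>card ?V. \<Sum>P\<in>{P \<in> ?R. card P = k}. \<Prod>i<card P. x - i)"
  proof -
    have "finite ?R" "card ` ?R \<subseteq> {..card ?V}" using finQ card_le by auto
    from sum.group[OF this(1) _ this(2), of "\<lambda>P. \<Prod>i<card P. x - i"] show ?thesis by simp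
  qed
  also have "\<dots> = (\<Sum>k\<le>card ?V. S G k * (\<Prod>i<k. x - i))"
    by (rule sum.cong) (simp_all add: S_def stable_partitions_def conj_assoc)
  finally show ?thesis .
qed

section \<open>Dobinski-type series for \<open>\<B>\<close> and \<open>\<T>\<close>\<close>

lemma sums_falling_factorial: "(\<lambda>x. real (\<Prod>i<k. x - i) / fact x) sums exp 1"
proof -
  \<comment> \<open>Truncated subtraction makes the product vanish for \<open>x < k\<close>; the
    remaining terms form the exponential series at \<open>1\<close>, shifted by
    \<open>k\<close>.\<close>
  have eq: "real (\<Prod>i<k. x - i) / fact x = (if k \<le> x then 1 / fact (x - k) else 0)" for x
  proof (induction k)
    case (Suc k)
    show ?case
    proof (cases "Suc k \<le> x")
      case True
      then have "x - k = Suc (x - Suc k)" by simp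
      then have "fact (x - k) = real (x - k) * fact (x - Suc k)" by (metis fact_Suc)
      moreover have "real (x - k) \<noteq> 0" using True by simp
      ultimately have *: "1 / fact (x - k) * real (x - k) = 1 / fact (x - Suc k)" by simp
      have "real (\<Prod>i<Suc k. x - i) / fact x = real (\<Prod>i<k. x - i) / fact x * real (x - k)"
        by simp
      also have "\<dots> = 1 / fact (x - Suc k)"
        unfolding Suc using True * by simp
      finally show ?thesis using True by simp
    next
      case False
      \<comment> \<open>At \<open>x = k\<close> the new factor \<open>x - k\<close> is
        \<open>0\<close>; for smaller \<open>x\<close> the shorter product was \<open>0\<close>
        already.\<close>
      then show ?thesis using Suc by (cases "k = x") auto
    qed
  qed simp
  have "(\<lambda>x. 1 / fact x) sums exp (1::real)"
    using exp_converges[of "1::real"] by (simp add: field_simps)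
  then have "(\<lambda>x. real (\<Prod>i<k. (x + k) - i) / fact (x + k)) sums exp 1"
    unfolding eq by simp
  moreover have "(\<Sum>x<k. real (\<Prod>i<k. x - i) / fact x) = 0"
    unfolding eq by simp
  ultimately show ?thesis
    using sums_iff_shift[of "\<lambda>x. real (\<Prod>i<k. x - i) / fact x" k "exp 1"] by (simp only: add_0_right)
qed

text \<open>Writing \<open>x = (x - k) + k\<close> splits the product into falling factorials of
  lengths \<open>Suc k\<close> and \<open>k\<close>, and the series of each sums to
  \<open>exp 1\<close>.\<close>

lemma sums_times_falling_factorial:
  "(\<lambda>x. real x * (real (\<Prod>i<k. x - i) / fact x)) sums ((real k + 1) * exp 1)"
proof -
  have "real x * real (\<Prod>i<k. x - i) = real (\<Prod>i<Suc k. x - i) + real k * real (\<Prod>i<k. x - i)" for x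
  \<comment> \<open>For \<open>x < k\<close> both products vanish, so the identity survives
    truncated subtraction.\<close>
  proof (cases "k \<le> x")
    case False
    then have *: "(\<Prod>i<k. x - i) = 0" by (auto intro!: bexI[of _ x])
    show ?thesis unfolding prod.lessThan_Suc * by simp
  qed (simp add: algebra_simps of_nat_diff)
  then have "real x * (real (\<Prod>i<k. x - i) / fact x)
    = real (\<Prod>i<Suc k. x - i) / fact x + real k * (real (\<Prod>i<k. x - i) / fact x)" for x
    by (simp add: field_simps)
  moreover have "(\<lambda>x. real (\<Prod>i<Suc k. x - i) / fact x + real k * (real (\<Prod>i<k. x - i) / fact x))
     sums (exp 1 + real k * exp 1)"
    by (intro sums_add sums_mult sums_falling_factorial)
  ultimately show ?thesis by (simp add: algebra_simps)
qed

lemma sums_colorings_\<B>: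
  assumes "pair_graph G"
  shows "(\<lambda>x. real (card (colorings G x)) / fact x) sums (exp 1 * real (\<B> G))"
proof -
  have "(\<lambda>x. \<Sum>k\<le>card (pverts G). real (S G k) * (real (\<Prod>i<k. x - i) / fact x))
    sums (\<Sum>k\<le>card (pverts G). real (S G k) * exp 1)"
    by (intro sums_sum sums_mult sums_falling_factorial)
  then show ?thesis
    unfolding card_colorings[OF assms]
    by (simp add: \<B>_def sum_divide_distrib sum_distrib_left mult.commute)
qed

text \<open>The extra \<open>\<B> G\<close> comes from the \<open>1\<close> in
  \<open>real k + 1\<close>; it is why the weighted mean is \<open>\<A> G + 1\<close>.\<close>

lemma sums_colorings_\<T>:
  assumes "pair_graph G"
  shows "(\<lambda>x. real x * (real (card (colorings G x)) / fact x)) sums (exp 1 * (real (\<T> G) + real (\<B> G)))"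
proof -
  have "(\<lambda>x. \<Sum>k\<le>card (pverts G). real (S G k) * (real x * (real (\<Prod>i<k. x - i) / fact x)))
    sums (\<Sum>k\<le>card (pverts G). real (S G k) * ((real k + 1) * exp 1))"
    by (intro sums_sum sums_mult sums_times_falling_factorial)
  moreover have "(\<Sum>k\<le>card (pverts G). real (S G k) * ((real k + 1) * exp 1))
     = exp 1 * (real (\<T> G) + real (\<B> G))"
    by (simp add: \<B>_def \<T>_def sum_distrib_left algebra_simps flip: sum.distrib)
  moreover have "real x * (real (card (colorings G x)) / fact x) =
    (\<Sum>k\<le>card (pverts G). real (S G k) * (real x * (real (\<Prod>i<k. x - i) / fact x)))" for x
    unfolding card_colorings[OF assms]
    by (simp add: sum_divide_distrib sum_distrib_left mult_ac)
  ultimately show ?thesis by simp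
qed

section \<open>Colorings of paths and cycles\<close>

lemma card_colorings_add_isolated:
  "card (colorings (add_isolated G p) x) = x ^ p * card (colorings G x)"
proof -
  have "bij_betw (\<lambda>f. (f \<circ> Inl, f \<circ> Inr)) (colorings (add_isolated G p) x)
     (colorings G x \<times> ({..<p} \<rightarrow>\<^sub>E {..<x}))"
  proof (rule bij_betw_byWitness[where f' = "\<lambda>(g, h). case_sum g h"])
    show "(\<lambda>f. (f \<circ> Inl, f \<circ> Inr)) ` colorings (add_isolated G p) x \<subseteq> colorings G x \<times> ({..<p} \<rightarrow>\<^sub>E {..<x})"
      by (force simp: colorings_def add_isolated_def PiE_iff extensional_def)
    show "(\<lambda>(g, h). case_sum g h) ` (colorings G x \<times> ({..<p} \<rightarrow>\<^sub>E {..<x})) \<subseteq> colorings (add_isolated G p) x"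
      by (auto simp: colorings_def add_isolated_def PiE_iff extensional_def split: sum.splits)
  qed (auto simp: fun_eq_iff split: sum.splits)
  then have "card (colorings (add_isolated G p) x) = card (colorings G x \<times> ({..<p} \<rightarrow>\<^sub>E {..<x}))"
    by (rule bij_betw_same_card)
  then show ?thesis by (simp add: card_cartesian_product card_funcsetE)
qed

lemma colorings_path_graph:
  "colorings (path_graph n) x = {f \<in> {..<n} \<rightarrow>\<^sub>E {..<x}. \<forall>i. Suc i < n \<longrightarrow> f i \<noteq> f (Suc i)}"
proof -
  have "(\<forall>(i, j)\<in>parcs (path_graph n). f i \<noteq> f j) \<longleftrightarrow> (\<forall>i. Suc i < n \<longrightarrow> f i \<noteq> f (Suc i))"
    for f :: "nat \<Rightarrow> nat"
  proof
    assume *: "\<forall>(i, j)\<in>parcs (path_graph n). f i \<noteq> f j"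
    show "\<forall>i. Suc i < n \<longrightarrow> f i \<noteq> f (Suc i)"
    proof (intro allI impI)
      fix i assume "Suc i < n"
      then have "(i, Suc i) \<in> parcs (path_graph n)" by (simp add: path_graph_def)
      with * show "f i \<noteq> f (Suc i)" by blast
    qed
  next
    assume *: "\<forall>i. Suc i < n \<longrightarrow> f i \<noteq> f (Suc i)"
    show "\<forall>(i, j)\<in>parcs (path_graph n). f i \<noteq> f j"
    proof clarify
      fix i j assume "(i, j) \<in> parcs (path_graph n)" "f i = f j"
      then show False
        using *[rule_format, of i] *[rule_format, of j] by (auto simp: path_graph_def)
    qed
  qed
  then show ?thesis by (simp add: colorings_def path_graph_def)
qed

lemma colorings_cycle_graph:
  "colorings (cycle_graph (Suc m)) x = {f \<in> colorings (path_graph (Suc m)) x. f m \<noteq> f 0}"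
proof -
  have "(\<forall>(i, j)\<in>parcs (cycle_graph (Suc m)). f i \<noteq> f j) \<longleftrightarrow>
    (\<forall>i. Suc i < Suc m \<longrightarrow> f i \<noteq> f (Suc i)) \<and> f m \<noteq> f 0" for f :: "nat \<Rightarrow> nat"
  proof -
    have "(\<forall>(i, j)\<in>parcs (cycle_graph (Suc m)). f i \<noteq> f j) \<longleftrightarrow>
        (\<forall>i<Suc m. f i \<noteq> f (Suc i mod Suc m))"
    proof
      assume *: "\<forall>(i, j)\<in>parcs (cycle_graph (Suc m)). f i \<noteq> f j"
      show "\<forall>i<Suc m. f i \<noteq> f (Suc i mod Suc m)"
      proof (intro allI impI)
        fix i assume "i < Suc m"
        then have "(i, Suc i mod Suc m) \<in> parcs (cycle_graph (Suc m))" by (simp add: cycle_graph_def)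
        with * show "f i \<noteq> f (Suc i mod Suc m)" by blast
      qed
    next
      assume *: "\<forall>i<Suc m. f i \<noteq> f (Suc i mod Suc m)"
      show "\<forall>(i, j)\<in>parcs (cycle_graph (Suc m)). f i \<noteq> f j"
      proof clarify
        fix i j assume "(i, j) \<in> parcs (cycle_graph (Suc m))" "f i = f j"
        then show False
          using *[rule_format, of i] *[rule_format, of j] by (auto simp: cycle_graph_def)
      qed
    qed
    \<comment> \<open>The index \<open>i = m\<close> is split off: there
      \<open>Suc i mod Suc m = 0\<close>, which is the closing edge.\<close>
    also have "\<dots> \<longleftrightarrow> (\<forall>i. Suc i < Suc m \<longrightarrow> f i \<noteq> f (Suc i)) \<and> f m \<noteq> f 0"
      by (auto simp: All_less_Suc)
    finally show ?thesis .
  qed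
  moreover have "pverts (cycle_graph (Suc m)) = {..<Suc m}" by (simp add: cycle_graph_def)
  ultimately show ?thesis
    unfolding colorings_path_graph colorings_def[of "cycle_graph (Suc m)"] by simp
qed

lemma finite_colorings_path_graph [simp]: "finite (colorings (path_graph n) x)"
  unfolding colorings_path_graph by (rule finite_subset[OF _ finite_PiE[of "{..<n}" "\<lambda>_. {..<x}"]]) auto

text \<open>The new end vertex only avoids the color of its neighbor, so every \<open>g\<close> has
  the same number of extensions.\<close>

lemma bij_betw_extend_path_coloring:
  "bij_betw (\<lambda>(g, c). g(Suc m := c))
     (SIGMA g:colorings (path_graph (Suc m)) x. {..<x} - {g m}) (colorings (path_graph (Suc (Suc m))) x)"
proof (rule bij_betw_byWitness[where f' = "\<lambda>f. (restrict f {..<Suc m}, f (Suc m))"])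
  let ?A = "SIGMA g:colorings (path_graph (Suc m)) x. {..<x} - {g m}"
  let ?B = "colorings (path_graph (Suc (Suc m))) x"
  show "\<forall>a\<in>?A. (\<lambda>f. (restrict f {..<Suc m}, f (Suc m))) ((\<lambda>(g, c). g(Suc m := c)) a) = a"
    by (auto simp: colorings_path_graph fun_eq_iff PiE_iff extensional_def)
  show "\<forall>f\<in>?B. (\<lambda>(g, c). g(Suc m := c)) ((\<lambda>f. (restrict f {..<Suc m}, f (Suc m))) f) = f"
    by (auto simp: colorings_path_graph fun_eq_iff PiE_iff extensional_def)
  show "(\<lambda>(g, c). g(Suc m := c)) ` ?A \<subseteq> ?B"
    by (auto simp: colorings_path_graph PiE_iff extensional_def less_Suc_eq)
  show "(\<lambda>f. (restrict f {..<Suc m}, f (Suc m))) ` ?B \<subseteq> ?A"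
    by (auto simp: colorings_path_graph PiE_iff extensional_def less_Suc_eq)
qed

lemma card_colorings_path_graph:
  "real (card (colorings (path_graph (Suc m)) x)) = real x * (real x - 1) ^ m"
proof (induction m)
  case 0
  have "colorings (path_graph (Suc 0)) x = {..<Suc 0} \<rightarrow>\<^sub>E {..<x}"
    by (auto simp: colorings_path_graph)
  then show ?case by (simp add: card_funcsetE)
next
  case (Suc m)
  have "real (card (colorings (path_graph (Suc (Suc m))) x))
     = real (card (SIGMA g:colorings (path_graph (Suc m)) x. {..<x} - {g m}))"
    using bij_betw_same_card[OF bij_betw_extend_path_coloring] by metis
  also have "\<dots> = (\<Sum>g\<in>colorings (path_graph (Suc m)) x. real (card ({..<x} - {g m})))"
    by simp
  also have "\<dots> = (\<Sum>g\<in>colorings (path_graph (Suc m)) x. real x - 1)"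
  proof (rule sum.cong)
    fix g assume "g \<in> colorings (path_graph (Suc m)) x"
    \<comment> \<open>A coloring exists only for \<open>x > 0\<close>, where
      \<open>real x - 1\<close> is the true count; for \<open>x = 0\<close> the sum is
      empty.\<close>
    then have "g m < x" by (auto simp: colorings_path_graph PiE_iff)
    then show "real (card ({..<x} - {g m})) = real x - 1"
      by (simp add: card_Diff_singleton of_nat_diff)
  qed simp
  finally show ?case using Suc by simp
qed

text \<open>
  A coloring of the path either has distinct end colors or, dropping its last vertex, is a coloring
  of the shorter cycle. This also holds for \<open>m = 0\<close>, where the loop of \<open>cycle_graph 1\<close> excludes all
  colorings.
\<close>

lemma card_colorings_path_eq_cycles:
  "card (colorings (path_graph (Suc (Suc m))) x) =
   card (colorings (cycle_graph (Suc (Suc m))) x) + card (colorings (cycle_graph (Suc m)) x)"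
proof -
  let ?P = "colorings (path_graph (Suc (Suc m))) x"
  let ?Q = "{f \<in> ?P. f (Suc m) = f 0}"
  have "bij_betw (\<lambda>f. restrict f {..<Suc m}) ?Q (colorings (cycle_graph (Suc m)) x)"
  proof (rule bij_betw_byWitness[where f' = "\<lambda>g. g(Suc m := g 0)"])
    show "\<forall>f\<in>?Q. (restrict f {..<Suc m})(Suc m := restrict f {..<Suc m} 0) = f"
      by (auto simp: colorings_path_graph fun_eq_iff PiE_iff extensional_def)
    show "\<forall>g\<in>colorings (cycle_graph (Suc m)) x. restrict (g(Suc m := g 0)) {..<Suc m} = g"
      by (auto simp: colorings_cycle_graph colorings_path_graph fun_eq_iff PiE_iff extensional_def)
    show "(\<lambda>f. restrict f {..<Suc m}) ` ?Q \<subseteq> colorings (cycle_graph (Suc m)) x"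
    proof (rule image_subsetI)
      fix f assume "f \<in> ?Q"
      then have f: "f \<in> {..<Suc (Suc m)} \<rightarrow>\<^sub>E {..<x}" "\<And>i. i < Suc m \<Longrightarrow> f i \<noteq> f (Suc i)" "f (Suc m) = f 0"
        by (auto simp: colorings_path_graph)
      have "f m \<noteq> f 0" using f(2)[of m] f(3) by simp
      with f(1,2) show "restrict f {..<Suc m} \<in> colorings (cycle_graph (Suc m)) x"
        by (auto simp: colorings_cycle_graph colorings_path_graph)
    qed
    show "(\<lambda>g. g(Suc m := g 0)) ` colorings (cycle_graph (Suc m)) x \<subseteq> ?Q"
      by (auto simp: colorings_cycle_graph colorings_path_graph PiE_iff extensional_def less_Suc_eq)
  qed
  then have "card ?Q = card (colorings (cycle_graph (Suc m)) x)" by (rule bij_betw_same_card)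
  moreover have "?P = colorings (cycle_graph (Suc (Suc m))) x \<union> ?Q"
    by (auto simp: colorings_cycle_graph)
  moreover have "card (colorings (cycle_graph (Suc (Suc m))) x \<union> ?Q) =
      card (colorings (cycle_graph (Suc (Suc m))) x) + card ?Q"
    by (rule card_Un_disjoint) (auto simp: colorings_cycle_graph)
  ultimately show ?thesis by simp
qed

text \<open>Induction along \<open>card_colorings_path_eq_cycles\<close>, starting from the
  one-vertex cycle, whose loop leaves \<open>(x - 1) - (x - 1) = 0\<close> colorings.\<close>

lemma card_colorings_cycle_graph:
  "real (card (colorings (cycle_graph (Suc m)) x)) =
     (real x - 1) ^ Suc m + (-1) ^ Suc m * (real x - 1)"
proof (induction m)
  case 0
  show ?case by (simp add: colorings_cycle_graph)
next
  case (Suc m)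
  have "real (card (colorings (cycle_graph (Suc (Suc m))) x)) =
      real x * (real x - 1) ^ Suc m - real (card (colorings (cycle_graph (Suc m)) x))"
    using card_colorings_path_graph[of "Suc m" x] card_colorings_path_eq_cycles[of m x] by linarith
  then show ?case by (simp add: Suc algebra_simps)
qed

section \<open>Comparison of the weighted means\<close>

text \<open>
  Here \<open>s\<close> is the value at \<open>x\<close> of a function with values in \<open>[0, \<delta>]\<close>. The constant subtracted from it
  does not depend on \<open>x\<close>: it interpolates linearly between \<open>\<delta>\<close> at \<open>\<lfloor>M\<rfloor>\<close> and \<open>0\<close> at \<open>\<lfloor>M\<rfloor> + 1\<close>, the
  steepest descent that such a function can have.
\<close>

lemma integer_gap_below:
  fixes x :: int and M \<delta> s :: real
  assumes "0 \<le> s" "s \<le> \<delta>"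
  shows "(s - \<delta> * (of_int \<lfloor>M\<rfloor> + 1 - M)) * (of_int x - M) \<ge> - \<delta> * (of_int x - M)\<^sup>2"
\<comment> \<open>Integrality gives \<open>x \<le> \<lfloor>M\<rfloor>\<close> on the left, where
  \<open>s \<le> \<delta>\<close> yields the bound, and
  \<open>x \<ge> \<lfloor>M\<rfloor> + 1\<close> on the right, where \<open>0 \<le> s\<close>
  does.\<close>
proof (cases "real_of_int x \<le> M")
  case True
  then have "x \<le> \<lfloor>M\<rfloor>" by (simp add: le_floor_iff)
  then have "of_int x - M \<le> of_int \<lfloor>M\<rfloor> - M" by simp
  then have "\<delta> * (of_int x - M) \<le> \<delta> * (of_int \<lfloor>M\<rfloor> - M)"
    using assms by (intro mult_left_mono) auto
  then have "s - \<delta> * (of_int \<lfloor>M\<rfloor> + 1 - M) \<le> - \<delta> * (of_int x - M)"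
    using assms by (simp add: algebra_simps)
  from mult_right_mono_neg[OF this, of "of_int x - M"] True show ?thesis
    by (simp add: power2_eq_square)
next
  case False
  then have "\<lfloor>M\<rfloor> + 1 \<le> x" by linarith
  then have "real_of_int (\<lfloor>M\<rfloor> + 1) \<le> of_int x" by (simp only: of_int_le_iff)
  then have "of_int \<lfloor>M\<rfloor> + 1 - M \<le> of_int x - M" by simp
  then have "\<delta> * (of_int \<lfloor>M\<rfloor> + 1 - M) \<le> \<delta> * (of_int x - M)"
    using assms by (intro mult_left_mono) auto
  then have "s - \<delta> * (of_int \<lfloor>M\<rfloor> + 1 - M) \<ge> - \<delta> * (of_int x - M)"
    using assms by linarith
  from mult_right_mono[OF this, of "of_int x - M"] False show ?thesis
    by (simp add: power2_eq_square)
qed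

text \<open>The mirror image, for an error that lowers the ratio: the constant now follows the
  steepest ascent, from \<open>0\<close> at \<open>\<lfloor>M\<rfloor>\<close> to
  \<open>\<delta>\<close> at \<open>\<lfloor>M\<rfloor> + 1\<close>. The upper bound on
  \<open>s\<close> is asked to the right of \<open>M\<close> only, as the error for even
  \<open>m\<close> is \<open>1\<close> at \<open>x = 2\<close>.\<close>

lemma integer_gap_above:
  fixes x :: int and M \<delta> s :: real
  assumes "0 \<le> s" "0 \<le> \<delta>" "M < of_int x \<Longrightarrow> s \<le> \<delta>"
  shows "(s - \<delta> * (M - of_int \<lfloor>M\<rfloor>)) * (of_int x - M) \<le> \<delta> * (of_int x - M)\<^sup>2"
proof (cases "real_of_int x \<le> M")
  case True
  then have "x \<le> \<lfloor>M\<rfloor>" by (simp add: le_floor_iff)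
  then have "of_int x - M \<le> of_int \<lfloor>M\<rfloor> - M" by simp
  then have "\<delta> * (of_int x - M) \<le> \<delta> * (of_int \<lfloor>M\<rfloor> - M)"
    using assms by (intro mult_left_mono) auto
  then have "s - \<delta> * (M - of_int \<lfloor>M\<rfloor>) \<ge> \<delta> * (of_int x - M)"
    using assms by (simp add: algebra_simps)
  from mult_right_mono_neg[OF this, of "of_int x - M"] True show ?thesis
    by (simp add: power2_eq_square)
next
  case False
  then have "\<lfloor>M\<rfloor> + 1 \<le> x" by linarith
  then have "real_of_int (\<lfloor>M\<rfloor> + 1) \<le> of_int x" by (simp only: of_int_le_iff)
  then have "1 - (M - of_int \<lfloor>M\<rfloor>) \<le> of_int x - M" by simp
  then have "\<delta> * (1 - (M - of_int \<lfloor>M\<rfloor>)) \<le> \<delta> * (of_int x - M)"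
    using assms by (intro mult_left_mono) auto
  then have "s - \<delta> * (M - of_int \<lfloor>M\<rfloor>) \<le> \<delta> * (of_int x - M)"
    using assms False by (simp add: algebra_simps)
  from mult_right_mono[OF this, of "of_int x - M"] False show ?thesis
    by (simp add: power2_eq_square)
qed

section \<open>Termwise bounds for the two parities of \<open>m\<close>\<close>

text \<open>Here \<open>w = (x + s) * c\<close> with \<open>0 \<le> s \<le> 1/5\<close>. Subtracting
  the multiple of \<open>c\<close> suggested by \<open>integer_gap_below\<close> lets the error
  consume at most a fifth of the square.\<close>

lemma path_term_bound_odd:
  fixes M :: real and m p x :: nat
  assumes m: "odd m" "m \<ge> 5" and x: "x \<ge> 3"
  defines "w \<equiv> real x ^ p * (real x * (real x - 1) ^ m)"
    and "c \<equiv> real x ^ p * ((real x - 1) ^ m + (-1) ^ m * (real x - 1))"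
  shows "(w - (M + 1/5 * (of_int \<lfloor>M\<rfloor> + 1 - M)) * c) * (real x - M) \<ge> 4/5 * c * (real x - M)\<^sup>2"
    and "c \<ge> 0"
proof -
  define y where "y = real x - 1"
  have y: "y \<ge> 2" and xy: "real x = y + 1" using x by (auto simp: y_def)
  obtain k where k: "m = k + 5" using m by (metis add.commute le_Suc_ex)
  have "y ^ 4 \<le> y ^ (m - 1)" using y k by (intro power_increasing) auto
  moreover have "5 * (y + 1) \<le> y ^ 4 - 1"
  \<comment> \<open>The factor \<open>(y\<^sup>2 + 1) * (y - 1)\<close> equals \<open>5\<close> at
    \<open>y = 2\<close>: the bound \<open>1/5\<close> is the value of \<open>s\<close> for
    \<open>x = 3\<close> and \<open>m = 5\<close>.\<close>
  proof -
    have "5 * 1 \<le> (y\<^sup>2 + 1) * (y - 1)"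
      using y power_mono[of 2 y 2] by (intro mult_mono) auto
    then have "5 * (y + 1) \<le> (y\<^sup>2 + 1) * (y - 1) * (y + 1)"
      using y by (intro mult_right_mono) auto
    also have "\<dots> = y ^ 4 - 1" by (simp add: algebra_simps power2_eq_square power4_eq_xxxx)
    finally show ?thesis .
  qed
  ultimately have D: "5 * (y + 1) \<le> y ^ (m - 1) - 1" by linarith
  define s where "s = (y + 1) / (y ^ (m - 1) - 1)"
  have s: "0 \<le> s" "s \<le> 1/5" using D y by (auto simp: s_def field_simps)
  have ym: "y ^ m = y * y ^ (m - 1)" using k by (intro power_eq_if[THEN trans]) simp
  have c: "c = real x ^ p * y * (y ^ (m - 1) - 1)"
    using m by (simp add: c_def ym algebra_simps flip: y_def)
  show c0: "c \<ge> 0" unfolding c using y D by (intro mult_nonneg_nonneg) auto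
  have "s * c = real x ^ p * y * (y + 1)"
    using D y by (simp add: s_def c)
  then have "w = real x * c + s * c"
    by (simp add: w_def c ym xy algebra_simps flip: y_def)
  then have "(w - (M + \<kappa>) * c) * (real x - M) = c * ((real x - M)\<^sup>2 + (s - \<kappa>) * (real x - M))" for \<kappa>
    by (simp add: algebra_simps power2_eq_square)
  then have "(w - (M + 1/5 * (of_int \<lfloor>M\<rfloor> + 1 - M)) * c) * (real x - M)
     = c * ((real x - M)\<^sup>2 + (s - 1/5 * (of_int \<lfloor>M\<rfloor> + 1 - M)) * (real x - M))" .
  also have "\<dots> \<ge> c * ((real x - M)\<^sup>2 + (- (1/5)) * (real x - M)\<^sup>2)"
    using integer_gap_below[OF s, where M = M and x = "int x"] c0 by (intro mult_left_mono add_left_mono) auto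
  finally show "(w - (M + 1/5 * (of_int \<lfloor>M\<rfloor> + 1 - M)) * c) * (real x - M) \<ge> 4/5 * c * (real x - M)\<^sup>2"
    by (simp add: algebra_simps)
qed

text \<open>Here the error is subtracted, \<open>w = (x - s) * c\<close>, so
  \<open>integer_gap_above\<close> applies and at most a third of the square is lost.\<close>

lemma path_term_bound_even:
  fixes M :: real and m p x :: nat
  assumes m: "even m" "m \<ge> 4" and x: "x \<ge> 2" and M: "M \<ge> 2"
  defines "w \<equiv> real x ^ p * (real x * (real x - 1) ^ m)"
    and "c \<equiv> real x ^ p * ((real x - 1) ^ m + (-1) ^ m * (real x - 1))"
  shows "(w - (M - 1/3 * (M - of_int \<lfloor>M\<rfloor>)) * c) * (real x - M) \<ge> 2/3 * c * (real x - M)\<^sup>2"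
    and "c > 0"
proof -
  define y where "y = real x - 1"
  have y: "y \<ge> 1" and xy: "real x = y + 1" using x by (auto simp: y_def)
  obtain k where k: "m = k + 4" using m by (metis add.commute le_Suc_ex)
  define s where "s = (y + 1) / (y ^ (m - 1) + 1)"
  have pos: "y ^ (m - 1) + 1 > 0" using y by (intro add_nonneg_pos) auto
  have s0: "0 \<le> s" using pos y by (auto simp: s_def)
  \<comment> \<open>Since \<open>M \<ge> 2\<close>, only \<open>x \<ge> 3\<close> is concerned;
    \<open>1/3\<close> is the value of \<open>s\<close> for \<open>x = 3\<close> and
    \<open>m = 4\<close>.\<close>
  have s1: "s \<le> 1/3" if "M < of_int (int x)"
  proof -
    have y2: "y \<ge> 2" using that M by (simp add: y_def)
    have "y ^ 3 \<le> y ^ (m - 1)" using y k by (intro power_increasing) auto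
    moreover have "3 * (y + 1) \<le> y ^ 3 + 1"
    proof -
      have "2 * 1 \<le> y * (y - 1)" using y2 by (intro mult_mono) auto
      then have "3 * (y + 1) \<le> (y * (y - 1) + 1) * (y + 1)"
        using y by (intro mult_right_mono) auto
      also have "\<dots> = y ^ 3 + 1" by (simp add: algebra_simps power3_eq_cube)
      finally show ?thesis .
    qed
    ultimately have "3 * (y + 1) \<le> y ^ (m - 1) + 1" by linarith
    then show ?thesis using pos by (simp add: s_def field_simps)
  qed
  have ym: "y ^ m = y * y ^ (m - 1)" using k by (intro power_eq_if[THEN trans]) simp
  have c: "c = real x ^ p * y * (y ^ (m - 1) + 1)"
    using m by (simp add: c_def ym algebra_simps flip: y_def)
  show c0: "c > 0" unfolding c using y x pos by (intro mult_pos_pos) auto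
  have "s * c = real x ^ p * y * (y + 1)"
    using pos by (simp add: s_def c)
  then have "w = real x * c - s * c"
    by (simp add: w_def c ym xy algebra_simps flip: y_def)
  then have weq: "w = (real x - s) * c" by (simp add: algebra_simps)
  have "(w - (M - \<kappa>) * c) * (real x - M) = c * ((real x - M)\<^sup>2 - (s - \<kappa>) * (real x - M))" for \<kappa>
    unfolding weq by (simp add: algebra_simps power2_eq_square)
  then have "(w - (M - 1/3 * (M - of_int \<lfloor>M\<rfloor>)) * c) * (real x - M)
     = c * ((real x - M)\<^sup>2 - (s - 1/3 * (M - of_int \<lfloor>M\<rfloor>)) * (real x - M))" .
  also have "\<dots> \<ge> c * ((real x - M)\<^sup>2 - 1/3 * (real x - M)\<^sup>2)"
    using integer_gap_above[of s "1/3" M "int x"] s0 s1 c0 by (intro mult_left_mono diff_left_mono) auto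
  finally show "(w - (M - 1/3 * (M - of_int \<lfloor>M\<rfloor>)) * c) * (real x - M) \<ge> 2/3 * c * (real x - M)\<^sup>2"
    by (simp add: algebra_simps)
qed

text \<open>
  As \<open>c x * (x - C1 / C) / x!\<close> sums to \<open>0\<close>, a multiple of \<open>c\<close> may be subtracted from \<open>w\<close> to make
  the terms nonnegative.
\<close>

lemma weighted_mean_less:
  fixes w c :: "nat \<Rightarrow> real"
  assumes W: "(\<lambda>x. w x / fact x) sums W" and W1: "(\<lambda>x. real x * (w x / fact x)) sums W1"
    and C: "(\<lambda>x. c x / fact x) sums C" and C1: "(\<lambda>x. real x * (c x / fact x)) sums C1"
    and C0: "C > 0"
    and I: "finite I" "\<And>x. x \<notin> I \<Longrightarrow> (w x - K * c x) * (real x - C1 / C) \<ge> 0"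
    and pos: "(\<Sum>x\<in>I. (w x - K * c x) * (real x - C1 / C) / fact x) > 0"
  shows "W * C1 < W1 * C"
proof -
  define M where "M = C1 / C"
  have "(\<lambda>x. (real x * (w x / fact x) - M * (w x / fact x)) - K * (real x * (c x / fact x) - M * (c x / fact x)))
     sums ((W1 - M * W) - K * (C1 - M * C))"
    by (intro sums_diff sums_mult W W1 C C1)
  moreover have "C1 - M * C = 0" using C0 by (simp add: M_def)
  ultimately have S: "(\<lambda>x. (w x - K * c x) * (real x - M) / fact x) sums (W1 - M * W)"
    by (simp add: algebra_simps diff_divide_distrib add_divide_distrib)
  \<comment> \<open>Terms outside \<open>I\<close> are nonnegative, so the finite sum bounds the
    series from below; \<open>I\<close> contains any negative terms and the source of
    strictness.\<close>
  have "(\<Sum>x\<in>I. (w x - K * c x) * (real x - M) / fact x) \<le> W1 - M * W"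
  proof -
    have "(\<Sum>x\<in>I. (w x - K * c x) * (real x - M) / fact x)
        \<le> (\<Sum>x. (w x - K * c x) * (real x - M) / fact x)"
      using I(2) by (intro sum_le_suminf sums_summable[OF S] I(1)) (auto simp: M_def)
    with sums_unique[OF S] show ?thesis by simp
  qed
  with pos have "W1 - M * W > 0" by (simp add: M_def)
  then have "(W1 - M * W) * C > 0" using C0 by simp
  then show ?thesis using C0 by (simp add: M_def algebra_simps)
qed

text \<open>The weights count colorings of \<open>P_(m+1)\<close> and \<open>C_m\<close>, each with
  \<open>p\<close> isolated vertices. The inequality compares the means \<open>C1 / C\<close> and
  \<open>W1 / W\<close> in cross-multiplied form.\<close>

lemma path_mean_greater:
  fixes m p :: nat
  defines "w \<equiv> (\<lambda>x. real x ^ p * (real x * (real x - 1) ^ m))"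
    and "c \<equiv> (\<lambda>x. real x ^ p * ((real x - 1) ^ m + (-1) ^ m * (real x - 1)))"
  assumes W: "(\<lambda>x. w x / fact x) sums W" and W1: "(\<lambda>x. real x * (w x / fact x)) sums W1"
    and C: "(\<lambda>x. c x / fact x) sums C" and C1: "(\<lambda>x. real x * (c x / fact x)) sums C1"
    and C0: "C > 0" and m: "m \<ge> 4"
  shows "W * C1 < W1 * C"
proof -
  define M where "M = C1 / C"
  have small: "w 0 = 0" "c 0 = 0" "w 1 = 0" "c 1 = 0"
    using m by (auto simp: w_def c_def)
  show ?thesis
  proof (cases "even m")
    case True
    \<comment> \<open>The weights \<open>c\<close> vanish at \<open>0\<close> and \<open>1\<close>
      and are positive from \<open>2\<close> on, hence \<open>M \<ge> 2\<close>.\<close>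
    have "c x * (real x - 2) \<ge> 0" for x
    proof (cases "x \<ge> 2")
      case x: True
      then show ?thesis using path_term_bound_even(2)[OF True m x order_refl, of p]
        by (simp add: c_def)
    next
      case False
      then have "x = 0 \<or> x = 1" by auto
      then show ?thesis using small by auto
    qed
    moreover have S: "(\<lambda>x. c x * (real x - 2) / fact x) sums (C1 - 2 * C)"
      using sums_diff[OF C1 sums_mult[OF C, of 2]] by (simp add: algebra_simps diff_divide_distrib)
    ultimately have "0 \<le> C1 - 2 * C"
      unfolding sums_unique[OF S] by (intro suminf_nonneg sums_summable[OF S]) simp
    then have M2: "M \<ge> 2" using C0 by (simp add: M_def field_simps)
    define K where "K = M - 1/3 * (M - of_int \<lfloor>M\<rfloor>)"
    have b: "(w x - K * c x) * (real x - M) \<ge> 2/3 * c x * (real x - M)\<^sup>2" "c x > 0" if "x \<ge> 2" for x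
      using path_term_bound_even[OF True m that M2, of p] by (auto simp: w_def c_def K_def)
    have nn: "(w x - K * c x) * (real x - M) \<ge> 0" for x
    proof (cases "x \<ge> 2")
      case x: True
      have "0 \<le> 2/3 * c x * (real x - M)\<^sup>2" using b(2)[OF x] by simp
      with b(1)[OF x] show ?thesis by linarith
    next
      case False
      then have "x = 0 \<or> x = 1" by auto
      then show ?thesis using small by auto
    qed
    \<comment> \<open>\<open>M\<close> cannot equal both \<open>2\<close> and \<open>3\<close>, so
      one of these terms is strictly positive.\<close>
    obtain x :: nat where x: "x \<ge> 2" "real x \<noteq> M"
      by (cases "M = 2") (auto intro: that[of 2] that[of 3])
    have "0 < 2/3 * c x * (real x - M)\<^sup>2" using b(2)[OF x(1)] x(2) by simp
    with b(1)[OF x(1)] have "(w x - K * c x) * (real x - M) > 0" by linarith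
    then show ?thesis
      using weighted_mean_less[OF W W1 C C1 C0, of "{x}" K] nn by (simp add: M_def)
  next
    case False
    with m have m5: "m \<ge> 5" by (cases "m = 4") auto
    define K where "K = M + 1/5 * (of_int \<lfloor>M\<rfloor> + 1 - M)"
    have b: "(w x - K * c x) * (real x - M) \<ge> 4/5 * c x * (real x - M)\<^sup>2" "c x \<ge> 0" if "x \<ge> 3" for x
      using path_term_bound_odd[OF False m5 that, of p] by (auto simp: w_def c_def K_def)
    have nn: "(w x - K * c x) * (real x - M) \<ge> 0" if "x \<noteq> 2" for x
    proof (cases "x \<ge> 3")
      case x: True
      have "0 \<le> 4/5 * c x * (real x - M)\<^sup>2" using b(2)[OF x] by simp
      with b(1)[OF x] show ?thesis by linarith
    next
      case False
      then have "x = 0 \<or> x = 1" using that by auto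
      then show ?thesis using small by auto
    qed
    define q where "q = (2::real) ^ p"
    have q: "q > 0" by (simp add: q_def)
    \<comment> \<open>An odd cycle has no 2-coloring, so \<open>c 2 = 0\<close> and \<open>K\<close>
      drops out; the term is negative when \<open>M > 2\<close>.\<close>
    have two: "(w 2 - K * c 2) * (real 2 - M) / fact 2 = q * (2 - M)"
      using False by (simp add: w_def c_def q_def)
    \<comment> \<open>For \<open>x \<ge> 3\<close>, replacing \<open>m\<close> by \<open>5\<close>
      and \<open>x ^ p\<close> by \<open>2 ^ p\<close> only lowers \<open>c\<close>, and gives all
      terms the common factor \<open>q\<close>.\<close>
    have cb: "c x / fact x \<ge> q * a"
      if "x \<ge> 3" "fact x * a \<le> (real x - 1) ^ 5 - (real x - 1)" "a \<ge> 0" for x a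
    proof -
      have "(real x - 1) ^ 5 \<le> (real x - 1) ^ m"
        using that m5 by (intro power_increasing) auto
      then have "fact x * a \<le> (real x - 1) ^ m - (real x - 1)" using that by linarith
      moreover have "q \<le> real x ^ p" unfolding q_def using that by (intro power_mono) auto
      ultimately have "q * (fact x * a) \<le> real x ^ p * ((real x - 1) ^ m - (real x - 1))"
        using q that by (intro mult_mono) auto
      then show ?thesis using False by (simp add: c_def field_simps)
    qed
    have tb: "(w x - K * c x) * (real x - M) / fact x \<ge> q * (4/5 * a * (real x - M)\<^sup>2)"
      if "x \<ge> 3" "fact x * a \<le> (real x - 1) ^ 5 - (real x - 1)" "a \<ge> 0" for x a
    proof -
      have "q * (4/5 * a * (real x - M)\<^sup>2) = 4/5 * (real x - M)\<^sup>2 * (q * a)" by simp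
      also have "\<dots> \<le> 4/5 * (real x - M)\<^sup>2 * (c x / fact x)"
        using cb[OF that] by (intro mult_left_mono) auto
      also have "\<dots> = 4/5 * c x * (real x - M)\<^sup>2 / fact x" by simp
      also have "\<dots> \<le> (w x - K * c x) * (real x - M) / fact x"
        using b(1)[OF that(1)] by (intro divide_right_mono) auto
      finally show ?thesis .
    qed
    \<comment> \<open>The numbers \<open>5\<close>, \<open>10\<close>, \<open>17/2\<close> are
      \<open>((x - 1) ^ 5 - (x - 1)) / x!\<close> at \<open>x = 3, 4, 5\<close>. The quadratic in
      \<open>M\<close> is least at \<open>785/188\<close>, where it is still positive.\<close>
    have "(0::real) < (2 - M) + 4/5 * 5 * (3 - M)\<^sup>2 + 4/5 * 10 * (4 - M)\<^sup>2 + 4/5 * (17/2) * (5 - M)\<^sup>2"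
    proof -
      have "(2 - M) + 4/5 * 5 * (3 - M)\<^sup>2 + 4/5 * 10 * (4 - M)\<^sup>2 + 4/5 * (17/2) * (5 - M)\<^sup>2
        = 94/5 * (M - 785/188)\<^sup>2 + (336 - 157\<^sup>2 / (4 * (94/5)))"
        by (simp add: power2_eq_square field_simps)
      also have "\<dots> > 0" by (intro add_nonneg_pos) (auto simp: power2_eq_square)
      finally show ?thesis .
    qed
    then have "0 < q * ((2 - M) + 4/5 * 5 * (3 - M)\<^sup>2 + 4/5 * 10 * (4 - M)\<^sup>2 + 4/5 * (17/2) * (5 - M)\<^sup>2)"
      using q by (rule mult_pos_pos[rotated])
    also have "\<dots> = q * (2 - M) + q * (4/5 * 5 * (real 3 - M)\<^sup>2) + q * (4/5 * 10 * (real 4 - M)\<^sup>2)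
        + q * (4/5 * (17/2) * (real 5 - M)\<^sup>2)"
      by (simp add: algebra_simps)
    also have "\<dots> \<le> (w 2 - K * c 2) * (real 2 - M) / fact 2 + (w 3 - K * c 3) * (real 3 - M) / fact 3
        + (w 4 - K * c 4) * (real 4 - M) / fact 4 + (w 5 - K * c 5) * (real 5 - M) / fact 5"
      by (intro add_mono tb) (simp_all only: two, simp_all add: fact_numeral)
    also have "\<dots> = (\<Sum>x\<in>{2,3,4,5}. (w x - K * c x) * (real x - M) / fact x)"
      by simp
    finally show ?thesis
      using weighted_mean_less[OF W W1 C C1 C0, of "{2,3,4,5}" K] nn by (simp add: M_def)
  qed
qed

section \<open>Positive denominators and the conclusion\<close>

text \<open>The cycle has a 3-coloring, so the term at \<open>x = 3\<close> of the nonnegative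
  series for \<open>\<B>\<close> is positive.\<close>

lemma \<B>_add_isolated_cycle_graph_pos:
  assumes "m \<ge> 2"
  shows "\<B> (add_isolated (cycle_graph (Suc m)) p) > 0"
proof -
  let ?G = "add_isolated (cycle_graph (Suc m)) p"
  have "pair_graph ?G" using assms by (simp add: pair_graph_add_isolated pair_graph_cycle_graph)
  note S = sums_colorings_\<B>[OF this]
  have "(2::real) < 2 ^ Suc m" using assms power_strict_increasing[of 1 "Suc m" "2::real"] by simp
  then have "0 < real (card (colorings (cycle_graph (Suc m)) 3))"
    unfolding card_colorings_cycle_graph by (cases "even m") auto
  then have "0 < real (card (colorings ?G 3)) / fact 3"
    unfolding card_colorings_add_isolated by simp
  then have "0 < (\<Sum>x. real (card (colorings ?G x)) / fact x)"
    by (intro suminf_pos2[OF sums_summable[OF S], of 3]) auto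
  then have "0 < exp (1::real) * real (\<B> ?G)"
    by (simp only: sums_unique[OF S])
  then show ?thesis by (simp add: zero_less_mult_iff)
qed

theorem theorem18:
  fixes n p :: nat
  assumes "n \<ge> 5"
  shows "\<A> (add_isolated (cycle_graph n) p) > \<A> (add_isolated (path_graph n) p)"
proof -
  \<comment> \<open>With \<open>k = n - 2\<close>, \<open>?D\<close> is the cycle on
    \<open>n - 1\<close> vertices and \<open>m = Suc k\<close> in
    \<open>path_mean_greater\<close>.\<close>
  obtain k where n: "n = Suc (Suc k)" and k: "k \<ge> 3"
    by (rule that[of "n - 2"]) (use assms in auto)
  let ?P = "add_isolated (path_graph n) p"
  let ?C = "add_isolated (cycle_graph n) p"
  let ?D = "add_isolated (cycle_graph (Suc k)) p"
  have P: "pair_graph ?P" and C: "pair_graph ?C" and D: "pair_graph ?D"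
    using assms k by (simp_all add: pair_graph_add_isolated pair_graph_path_graph pair_graph_cycle_graph)
  have PCD: "real (card (colorings ?P x)) = real (card (colorings ?C x)) + real (card (colorings ?D x))" for x
    unfolding card_colorings_add_isolated n card_colorings_path_eq_cycles
    by (simp add: algebra_simps)
  have BP: "real (\<B> ?P) = real (\<B> ?C) + real (\<B> ?D)"
  proof -
    have "(\<lambda>x. real (card (colorings ?P x)) / fact x) sums (exp 1 * real (\<B> ?C) + exp 1 * real (\<B> ?D))"
      using sums_add[OF sums_colorings_\<B>[OF C] sums_colorings_\<B>[OF D]]
      by (simp add: PCD add_divide_distrib)
    from sums_unique2[OF this sums_colorings_\<B>[OF P]] show ?thesis
      by (simp flip: distrib_left)
  qed
  have TP: "real (\<T> ?P) = real (\<T> ?C) + real (\<T> ?D)"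
  proof -
    have "(\<lambda>x. real x * (real (card (colorings ?P x)) / fact x)) sums
        (exp 1 * (real (\<T> ?C) + real (\<B> ?C)) + exp 1 * (real (\<T> ?D) + real (\<B> ?D)))"
      using sums_add[OF sums_colorings_\<T>[OF C] sums_colorings_\<T>[OF D]]
      by (simp add: PCD add_divide_distrib distrib_left)
    from sums_unique2[OF this sums_colorings_\<T>[OF P]] show ?thesis
      by (simp add: BP flip: distrib_left)
  qed
  have posC: "\<B> ?C > 0" and posD: "\<B> ?D > 0"
    using \<B>_add_isolated_cycle_graph_pos[of "Suc k" p] \<B>_add_isolated_cycle_graph_pos[of k p] k
    by (simp_all add: n)
  have w: "real (card (colorings ?P x)) = real x ^ p * (real x * (real x - 1) ^ Suc k)" for x
    by (simp add: card_colorings_add_isolated n card_colorings_path_graph)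
  have c: "real (card (colorings ?D x)) = real x ^ p * ((real x - 1) ^ Suc k + (-1) ^ Suc k * (real x - 1))" for x
    by (simp only: card_colorings_add_isolated of_nat_mult of_nat_power card_colorings_cycle_graph)
  have "exp 1 * real (\<B> ?P) * (exp 1 * (real (\<T> ?D) + real (\<B> ?D)))
      < exp 1 * (real (\<T> ?P) + real (\<B> ?P)) * (exp 1 * real (\<B> ?D))"
    using path_mean_greater[OF sums_colorings_\<B>[OF P, unfolded w] sums_colorings_\<T>[OF P, unfolded w]
        sums_colorings_\<B>[OF D, unfolded c] sums_colorings_\<T>[OF D, unfolded c]] posD k
    by simp
  then have "(exp 1 * exp 1) * (real (\<B> ?P) * (real (\<T> ?D) + real (\<B> ?D)))
      < (exp 1 * exp 1) * ((real (\<T> ?P) + real (\<B> ?P)) * real (\<B> ?D))"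
    by (simp only: mult_ac)
  then have "real (\<B> ?P) * (real (\<T> ?D) + real (\<B> ?D)) < (real (\<T> ?P) + real (\<B> ?P)) * real (\<B> ?D)"
    by (rule mult_left_less_imp_less) simp
  \<comment> \<open>The ratio for \<open>?P\<close> is the mediant of those for \<open>?C\<close>
    and \<open>?D\<close>; exceeding the one for \<open>?D\<close>, it lies below the one for
    \<open>?C\<close>.\<close>
  then have "real (\<T> ?P) * real (\<B> ?C) < real (\<T> ?C) * real (\<B> ?P)"
    unfolding BP TP by (simp add: algebra_simps)
  moreover have "real (\<B> ?P) > 0" using posC BP by simp
  ultimately show ?thesis
    using posC by (simp add: \<A>_def field_simps)
qed

end
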